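(* Consider partitioned systems $y'=f^{\{1\}}(y)+f^{\{2\}}(y)$ with two components, and the partitioned exponential methods (of W type and of split-RHS type), TPS-trees, coefficient maps $\mathsf{y}_{n+1}$, and numbers $1/\gamma_{\mathrm{W}}(\tau)$, $1/\gamma_{\mathrm{S}}(\tau)$ defined in the context. Let $p\ge 1$ be an integer. (1) A partitioned exponential method of W type has order $p$ only if $$\mathsf{y}_{n+1}(\tau)=\frac{1}{\gamma_{\mathrm{W}}(\tau)}\qquad\text{for all TPS-trees }\tau\text{ with }|\tau|\le p.$$ (2) A partitioned exponential method of split-RHS type has order $p$ only if $$\mathsf{y}_{n+1}(\tau)=\frac{1}{\gamma_{\mathrm{S}}(\tau)}\qquad\text{for all TPS-trees }\tau\text{ with }|\tau|\le p.$$
   Context: **Matrix functions.** $\varphi_k(z)=\sum_{i\ge 0} z^i/(k+i)!$. A $\Psi$ function with second lower index $j$ is a linear combination $\Psi(z)=\sum_{k=1}^{j}p_{j,k}\varphi_k(z)$ with real coefficients $p_{j,k}$ (which may depend on the upper indices of $\Psi$). For a function $G$ and nodes $Y_0=y_n,Y_1,Y_2,\dots$ the forward differences are $\Delta^{(1)}G(Y_i)=G(Y_{i+1})-G(Y_i)$, $\Delta^{(j)}G(Y_i)=\Delta^{(j-1)}G(Y_{i+1})-\Delta^{(j-1)}G(Y_i)$; $\Delta^{(j)}G(y_n)$ means $\Delta^{(j)}G(Y_0)$, and $\Delta_{Y^{\{q\}}}^{(j)}$ indicates that the nodes are $y_n,Y_1^{\{q\}},Y_2^{\{q\}},\dots$.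 **Problem.** $y'=F(y)=f^{\{1\}}(y)+f^{\{2\}}(y)$ on $\mathbb{R}^d$, $f^{\{m\}}$ smooth, $P=2$. In the split-RHS setting, $f^{\{m\}}(y)=\mathbf{L}^{\{m\}}y+\mathcal{N}^{\{m\}}(y)$ with $\mathbf{L}^{\{m\}}\in\mathbb{R}^{d\times d}$ and $\mathcal{N}^{\{m\}}$ smooth. In the W setting, arbitrary matrices $\mathbf{W}^{\{m\}}\in\mathbb{R}^{d\times d}$ are given. **Methods of W type** (two families; all $\alpha,\gamma,a,b,g$ and the coefficients of the $\Psi$'s are real method coefficients, $s^{\{m\}}$ are stage numbers): PEXPW: for $q=1,2$, $i=1,\dots,s^{\{q\}}$, $$k_i^{\{q\}}=\varphi_1\bigl(h\gamma_{i,i}^{\{q,q\}}\mathbf{W}^{\{q\}}\bigr)\Bigl(hf^{\{q\}}(u_i^{\{q\}})+h\mathbf{W}^{\{q\}}\sum_{m=1}^{2}\sum_{j=1}^{\min(i-1,s^{\{m\}})}\gamma_{i,j}^{\{q,m\}}k_j^{\{m\}}\Bigr),$$ $$u_i^{\{q\}}=y_n+\sum_{m=1}^{2}\sum_{j=1}^{\min(i-1,s^{\{m\}})}\alpha_{i,j}^{\{q,m\}}k_j^{\{m\}},\qquad y_{n+1}=y_n+\sum_{q=1}^{2}\sum_{i=1}^{s^{\{q\}}}b_i^{\{q\}}k_i^{\{q\}}.$$ PEPIRKW: for $q=1,2$, $i=1,\dots,s^{\{q\}}-1$, $$Y_i^{\{q\}}=y_n+\sum_{m=1}^{2}a_{i,1}^{\{q,m\}}\Psi_{i,1}^{\{q,m\}}\bigl(hg_{i,1}^{\{q,m\}}\mathbf{W}^{\{m\}}\bigr)hf^{\{m\}}(y_n)+\sum_{m=1}^{2}\sum_{j=2}^{i_Y^{\{m\}}}a_{i,j}^{\{q,m\}}\Psi_{i,j}^{\{q,m\}}\bigl(hg_{i,j}^{\{q,m\}}\mathbf{W}^{\{m\}}\bigr)h\Delta_{Y^{\{q\}}}^{(j-1)}f^{\{m\}}(y_n),$$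 $$y_{n+1}=y_n+\sum_{m=1}^{2}b_1^{\{m\}}\Psi_{s^{\{m\}},1}^{\{m,m\}}\bigl(hg_{s^{\{m\}},1}^{\{m,m\}}\mathbf{W}^{\{m\}}\bigr)hf^{\{m\}}(y_n)+\sum_{m=1}^{2}\sum_{j=2}^{s^{\{m\}}}b_j^{\{m\}}\Psi_{s^{\{m\}},j}^{\{m,m\}}\bigl(hg_{s^{\{m\}},j}^{\{m,m\}}\mathbf{W}^{\{m\}}\bigr)h\Delta_{Y^{\{m\}}}^{(j-1)}f^{\{m\}}(y_n),$$ where the upper limit $i_Y^{\{m\}}\le i$, so that only already computed stages are used. **Methods of split-RHS type** (PSEPIRK): with $s$ stages, writing $\bar m$ for the index other than $m$ and $G^{\{m\}}=\mathcal{N}^{\{m\}}+f^{\{\bar m\}}$, for $i=1,\dots,s-1$, $$Y_i=y_n+\sum_{m=1}^{2}\Bigl[a_{i,1}^{\{m\}}\Psi_{i,1}^{\{m\}}\bigl(hg_{i,1}^{\{m\}}\mathbf{L}^{\{m\}}\bigr)hF(y_n)+\sum_{l=2}^{i}a_{i,l}^{\{m\}}\Psi_{i,l}^{\{m\}}\bigl(hg_{i,l}^{\{m\}}\mathbf{L}^{\{m\}}\bigr)h\Delta^{(l-1)}G^{\{m\}}(y_n)\Bigr],$$ $$y_{n+1}=y_n+\sum_{m=1}^{2}\Bigl[b_{1}^{\{m\}}\Psi_{s,1}^{\{m\}}\bigl(hg_{s,1}^{\{m\}}\mathbf{L}^{\{m\}}\bigr)hF(y_n)+\sum_{l=2}^{s}b_{l}^{\{m\}}\Psi_{s,l}^{\{m\}}\bigl(hg_{s,l}^{\{m\}}\mathbf{L}^{\{m\}}\bigr)h\Delta^{(l-1)}G^{\{m\}}(y_n)\Bigr],$$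 with differences on the nodes $y_n,Y_1,Y_2,\dots$. **Order.** A method (a fixed choice of coefficients) has order $p$ if, whenever $y_n=y(t_n)$, one has $y_{n+1}-y(t_n+h)=O(h^{p+1})$ as $h\to0$, for every dimension $d$, every initial value and every problem: all smooth $f^{\{m\}}$ and all matrices $\mathbf{W}^{\{m\}}$ in the W case; all smooth $\mathcal{N}^{\{m\}}$ and all matrices $\mathbf{L}^{\{m\}}$ in the split-RHS case. **TPS-trees.** Finite (non-empty, unordered) rooted trees whose nodes are of four types: square of color 1 or 2, round of color 1 or 2, such that every square node has at most one child. $|\tau|$ is the number of nodes and $\sigma(\tau)$ the order of the symmetry group of $\tau$. A square node of color $m$ represents the matrix $\mathbf{A}^{\{m\}}$ and a round node of color $m$ represents the function $g^{\{m\}}$ and its derivatives, where $(\mathbf{A}^{\{m\}},g^{\{m\}})=(\mathbf{W}^{\{m\}},f^{\{m\}})$ for W type and $(\mathbf{L}^{\{m\}},\mathcal{N}^{\{m\}})$ for split-RHS type. Elementary differentials: a round root of color $m$ with subtrees $\tau_1,\dots,\tau_k$ ($k\ge0$) gives $F(\tau)(y)=(g^{\{m\}})^{(k)}(y)\bigl(F(\tau_1)(y),\dots,F(\tau_k)(y)\bigr)$; a square root of color $m$ with subtree $\tau_1$ gives $\mathbf{A}^{\{m\}}F(\tau_1)(y)$; a single square node of color $m$ gives $\mathbf{A}^{\{m\}}y$. **B-series.** For $\mathsf{a}:\{\text{TPS-trees}\}\cup\{\emptyset\}\to\mathbb{R}$, $B(\mathsf{a},y)=\mathsf{a}(\emptyset)y+\sum_\tau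 \mathsf{a}(\tau)\frac{h^{|\tau|}}{\sigma(\tau)}F(\tau)(y)$ (formal series in $h$). **Coefficients of the numerical solution.** $\mathsf{y}_{n+1}$ is the coefficient map for which $y_{n+1}=B(\mathsf{y}_{n+1},y_n)$ formally. It is obtained by executing the method's formulas on coefficient maps, starting from $y_n$ (coefficient $1$ on $\emptyset$ and $0$ on all trees), with linear combinations taken coefficientwise and the rules: (i) $h\,g^{\{m\}}(B(\mathsf{a},y))$, for $\mathsf{a}(\emptyset)=1$, has coefficient $\prod_i\mathsf{a}(\tau_i)$ on a tree whose root is round of color $m$ with subtrees $\tau_1,\dots,\tau_k$ (so $1$ if $k=0$), and $0$ otherwise; (ii) $h\,\mathbf{A}^{\{m\}}B(\mathsf{a},y)$ has coefficient $\mathsf{a}(\tau_1)$ on the tree whose root is square of color $m$ with single subtree $\tau_1$ (where $\tau_1=\emptyset$ is allowed), and $0$ otherwise; (iii) $\phi(h\mathbf{A}^{\{m\}})=\sum_i c_i(h\mathbf{A}^{\{m\}})^i$ is applied by iterating (ii) and summing. **Exact solution coefficients.** For a rooted tree let $\gamma$ be the usual density: $\gamma=1$ for a single node and $\gamma(\tau)=|\tau|\,\gamma(\tau_1)\cdots\gamma(\tau_k)$ if the root has subtrees $\tau_1,\dots,\tau_k$ (ignoring node types). Then $1/\gamma_{\mathrm{S}}(\tau)=1/\gamma(\tau)$ for every TPS-tree; $1/\gamma_{\mathrm{W}}(\tau)=1/\gamma(\tau)$ if $\tau$ has no square node, and $1/\gamma_{\mathrm{W}}(\tau)=0$ (as a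 symbol for the coefficient) if $\tau$ contains a square node. *)

theory Defs
  imports "HOL-Analysis.Analysis" "HOL-Library.Multiset" "HOL-Library.Landau_Symbols"
begin

section \<open>TPS-trees\<close>

datatype color = C1 | C2

primrec other :: "color \<Rightarrow> color" where
  "other C1 = C2"
| "other C2 = C1"

text \<open>Multisets of children make the trees unordered. Throughout, the symbol for the empty
  tree is \<open>None :: tps option\<close>; hence a square node without a child is \<open>Square m None\<close>.\<close>

datatype tps = Round color "tps multiset" | Square color "tps option"

primrec tsize :: "tps \<Rightarrow> nat" where
  "tsize (Round m ts) = 1 + sum_mset (image_mset tsize ts)"
| "tsize (Square m t) = 1 + (case map_option tsize t of None \<Rightarrow> 0 | Some n \<Rightarrow> n)"

primrec density :: "tps \<Rightarrow> nat" where
  "density (Round m ts) = tsize (Round m ts) * prod_mset (image_mset density ts)"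
| "density (Square m t) =
     tsize (Square m t) * (case map_option density t of None \<Rightarrow> 1 | Some n \<Rightarrow> n)"

primrec has_square :: "tps \<Rightarrow> bool" where
  "has_square (Round m ts) \<longleftrightarrow> True \<in># image_mset has_square ts"
| "has_square (Square m t) \<longleftrightarrow> True"

definition inv_gamma_S :: "tps \<Rightarrow> real" where
  "inv_gamma_S \<tau> = 1 / real (density \<tau>)"

definition inv_gamma_W :: "tps \<Rightarrow> real" where
  "inv_gamma_W \<tau> = (if has_square \<tau> then 0 else 1 / real (density \<tau>))"


section \<open>The methods\<close>

text \<open>The formulas of a method are executed both on vectors and on coefficient maps. Both are
  real-valued functions (\<open>nat \<Rightarrow> real\<close> and \<open>tps option \<Rightarrow> real\<close>), so each method is written once,
  over \<open>'x \<Rightarrow> real\<close> with pointwise linear combinations. Its parameters are the operators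
  \<open>hf m\<close>, \<open>hA m\<close> that stand for multiplication by the step size \<open>h\<close> after applying \<open>f\<^sup>{\<^sup>m\<^sup>}\<close> and
  \<open>A\<^sup>{\<^sup>m\<^sup>}\<close>. In particular \<open>h \<Delta>f\<close> is written as \<open>\<Delta>(h f)\<close>.\<close>

type_synonym 'x operator = "('x \<Rightarrow> real) \<Rightarrow> ('x \<Rightarrow> real)"

definition scale_op :: "real \<Rightarrow> 'x operator \<Rightarrow> 'x operator" where
  "scale_op c A v = (\<lambda>x. c * A v x)"

definition phi_op :: "nat \<Rightarrow> 'x operator \<Rightarrow> 'x operator" where
  "phi_op k A v = (\<lambda>x. \<Sum>i. (A ^^ i) v x / fact (k + i))"

definition psi_op :: "(nat \<Rightarrow> real) \<Rightarrow> nat \<Rightarrow> 'x operator \<Rightarrow> 'x operator" where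
  "psi_op c j A v = (\<lambda>x. \<Sum>k=1..j. c k * phi_op k A v x)"

primrec fdiff :: "nat \<Rightarrow> 'x operator \<Rightarrow> (nat \<Rightarrow> 'x \<Rightarrow> real) \<Rightarrow> nat \<Rightarrow> 'x \<Rightarrow> real" where
  "fdiff 0 G Y i = G (Y i)"
| "fdiff (Suc j) G Y i = (\<lambda>x. fdiff j G Y (Suc i) x - fdiff j G Y i x)"

lemma fdiff_cong [fundef_cong]:
  assumes "j = j'" "G = G'" "i = i'" "\<And>l. l \<le> i' + j' \<Longrightarrow> Y l = Y' l"
  shows "fdiff j G Y i = fdiff j' G' Y' i'"
proof -
  have "(\<And>l. l \<le> i + j \<Longrightarrow> Y l = Y' l) \<Longrightarrow> fdiff j G Y i = fdiff j G Y' i"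
    by (induction j arbitrary: i) auto
  then show ?thesis using assms by simp
qed


subsection \<open>PEXPW\<close>

record pexpw =
  w_s :: "color \<Rightarrow> nat"
  w_alpha :: "color \<Rightarrow> color \<Rightarrow> nat \<Rightarrow> nat \<Rightarrow> real"
  w_gamma :: "color \<Rightarrow> color \<Rightarrow> nat \<Rightarrow> nat \<Rightarrow> real"
  w_b :: "color \<Rightarrow> nat \<Rightarrow> real"

function pexpw_k :: "pexpw \<Rightarrow> (color \<Rightarrow> 'x operator) \<Rightarrow> (color \<Rightarrow> 'x operator) \<Rightarrow>
    ('x \<Rightarrow> real) \<Rightarrow> nat \<Rightarrow> color \<Rightarrow> 'x \<Rightarrow> real" where
  "pexpw_k M hf hW y i q =
     phi_op 1 (scale_op (w_gamma M q q i i) (hW q))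
       (\<lambda>x. hf q (\<lambda>x. y x + (\<Sum>m\<in>{C1, C2}. \<Sum>j=1..min (i - 1) (w_s M m).
                  w_alpha M q m i j * pexpw_k M hf hW y j m x)) x
          + hW q (\<lambda>x. \<Sum>m\<in>{C1, C2}. \<Sum>j=1..min (i - 1) (w_s M m).
                  w_gamma M q m i j * pexpw_k M hf hW y j m x) x)"
  by pat_completeness auto
termination
  by (relation "Wellfounded.measure (\<lambda>(M, hf, hW, y, i, q). i)") auto

definition pexpw_step :: "pexpw \<Rightarrow> (color \<Rightarrow> 'x operator) \<Rightarrow> (color \<Rightarrow> 'x operator) \<Rightarrow>
    'x operator" where
  "pexpw_step M hf hW y =
     (\<lambda>x. y x + (\<Sum>q\<in>{C1, C2}. \<Sum>i=1..w_s M q. w_b M q i * pexpw_k M hf hW y i q x))"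


subsection \<open>PEPIRKW\<close>

text \<open>\<open>e_p M q m j k\<close> is the coefficient \<open>p\<^sub>j\<^sub>,\<^sub>k\<close> of the \<open>\<Psi>\<close> functions with upper indices
  \<open>q, m\<close>. The bound on the upper limit, \<open>i\<^sub>Y \<le> i\<close>, is built in by using \<open>min (e_iY M i m) i\<close>.\<close>

record pepirkw =
  e_s :: "color \<Rightarrow> nat"
  e_iY :: "nat \<Rightarrow> color \<Rightarrow> nat"
  e_a :: "color \<Rightarrow> color \<Rightarrow> nat \<Rightarrow> nat \<Rightarrow> real"
  e_g :: "color \<Rightarrow> color \<Rightarrow> nat \<Rightarrow> nat \<Rightarrow> real"
  e_p :: "color \<Rightarrow> color \<Rightarrow> nat \<Rightarrow> nat \<Rightarrow> real"
  e_b :: "color \<Rightarrow> nat \<Rightarrow> real"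

function pepirkw_Y :: "pepirkw \<Rightarrow> (color \<Rightarrow> 'x operator) \<Rightarrow> (color \<Rightarrow> 'x operator) \<Rightarrow>
    ('x \<Rightarrow> real) \<Rightarrow> color \<Rightarrow> nat \<Rightarrow> 'x \<Rightarrow> real" where
  "pepirkw_Y M hf hW y q i =
     (if i = 0 then y else
      (\<lambda>x. y x
         + (\<Sum>m\<in>{C1, C2}. e_a M q m i 1 *
              psi_op (e_p M q m 1) 1 (scale_op (e_g M q m i 1) (hW m)) (hf m y) x)
         + (\<Sum>m\<in>{C1, C2}. \<Sum>j=2..min (e_iY M i m) i. e_a M q m i j *
              psi_op (e_p M q m j) j (scale_op (e_g M q m i j) (hW m))
                (fdiff (j - 1) (hf m) (\<lambda>l. pepirkw_Y M hf hW y q l) 0) x)))"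
  by pat_completeness auto
termination
  by (relation "Wellfounded.measure (\<lambda>(M, hf, hW, y, q, i). i)") auto

definition pepirkw_step :: "pepirkw \<Rightarrow> (color \<Rightarrow> 'x operator) \<Rightarrow> (color \<Rightarrow> 'x operator) \<Rightarrow>
    'x operator" where
  "pepirkw_step M hf hW y =
     (\<lambda>x. y x
        + (\<Sum>m\<in>{C1, C2}. e_b M m 1 *
             psi_op (e_p M m m 1) 1 (scale_op (e_g M m m (e_s M m) 1) (hW m)) (hf m y) x)
        + (\<Sum>m\<in>{C1, C2}. \<Sum>j=2..e_s M m. e_b M m j *
             psi_op (e_p M m m j) j (scale_op (e_g M m m (e_s M m) j) (hW m))
               (fdiff (j - 1) (hf m) (pepirkw_Y M hf hW y m) 0) x))"


subsection \<open>Methods of W type\<close>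

datatype w_scheme = PEXPW pexpw | PEPIRKW pepirkw

primrec w_step :: "w_scheme \<Rightarrow> (color \<Rightarrow> 'x operator) \<Rightarrow> (color \<Rightarrow> 'x operator) \<Rightarrow>
    'x operator" where
  "w_step (PEXPW M) = pexpw_step M"
| "w_step (PEPIRKW M) = pepirkw_step M"


subsection \<open>Methods of split-RHS type (PSEPIRK)\<close>

record psepirk =
  s_s :: nat
  s_a :: "color \<Rightarrow> nat \<Rightarrow> nat \<Rightarrow> real"
  s_g :: "color \<Rightarrow> nat \<Rightarrow> nat \<Rightarrow> real"
  s_p :: "color \<Rightarrow> nat \<Rightarrow> nat \<Rightarrow> real"
  s_b :: "color \<Rightarrow> nat \<Rightarrow> real"

definition split_hf :: "(color \<Rightarrow> 'x operator) \<Rightarrow> (color \<Rightarrow> 'x operator) \<Rightarrow> color \<Rightarrow> 'x operator" where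
  "split_hf hN hL m u = (\<lambda>x. hL m u x + hN m u x)"

definition split_hF :: "(color \<Rightarrow> 'x operator) \<Rightarrow> (color \<Rightarrow> 'x operator) \<Rightarrow> 'x operator" where
  "split_hF hN hL u = (\<lambda>x. split_hf hN hL C1 u x + split_hf hN hL C2 u x)"

definition split_hG :: "(color \<Rightarrow> 'x operator) \<Rightarrow> (color \<Rightarrow> 'x operator) \<Rightarrow> color \<Rightarrow> 'x operator" where
  "split_hG hN hL m u = (\<lambda>x. hN m u x + split_hf hN hL (other m) u x)"

function psepirk_Y :: "psepirk \<Rightarrow> (color \<Rightarrow> 'x operator) \<Rightarrow> (color \<Rightarrow> 'x operator) \<Rightarrow>
    ('x \<Rightarrow> real) \<Rightarrow> nat \<Rightarrow> 'x \<Rightarrow> real" where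
  "psepirk_Y M hN hL y i =
     (if i = 0 then y else
      (\<lambda>x. y x + (\<Sum>m\<in>{C1, C2}.
           s_a M m i 1 * psi_op (s_p M m 1) 1 (scale_op (s_g M m i 1) (hL m)) (split_hF hN hL y) x
         + (\<Sum>l=2..i. s_a M m i l * psi_op (s_p M m l) l (scale_op (s_g M m i l) (hL m))
              (fdiff (l - 1) (split_hG hN hL m) (\<lambda>j. psepirk_Y M hN hL y j) 0) x))))"
  by pat_completeness auto
termination
  by (relation "Wellfounded.measure (\<lambda>(M, hN, hL, y, i). i)") auto

definition psepirk_step :: "psepirk \<Rightarrow> (color \<Rightarrow> 'x operator) \<Rightarrow> (color \<Rightarrow> 'x operator) \<Rightarrow>
    'x operator" where
  "psepirk_step M hN hL y =
     (\<lambda>x. y x + (\<Sum>m\<in>{C1, C2}.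
          s_b M m 1 * psi_op (s_p M m 1) 1 (scale_op (s_g M m (s_s M) 1) (hL m))
            (split_hF hN hL y) x
        + (\<Sum>l=2..s_s M. s_b M m l * psi_op (s_p M m l) l (scale_op (s_g M m (s_s M) l) (hL m))
             (fdiff (l - 1) (split_hG hN hL m) (psepirk_Y M hN hL y) 0) x)))"

declare pexpw_k.simps [simp del] pepirkw_Y.simps [simp del] psepirk_Y.simps [simp del]


section \<open>Coefficients of the numerical solution\<close>

definition coeff_y :: "tps option \<Rightarrow> real" where
  "coeff_y t = (if t = None then 1 else 0)"

text \<open>\<open>h g(B(a, y))\<close>, where \<open>a None = 1\<close>.\<close>

definition coeff_fun :: "color \<Rightarrow> (tps option) operator" where
  "coeff_fun m a t =
     (case t of
        Some (Round m' ts) \<Rightarrow> if m' = m then prod_mset (image_mset (\<lambda>\<tau>. a (Some \<tau>)) ts) else 0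
      | _ \<Rightarrow> 0)"

text \<open>\<open>h A B(a, y)\<close>.\<close>

definition coeff_mat :: "color \<Rightarrow> (tps option) operator" where
  "coeff_mat m a t =
     (case t of Some (Square m' t1) \<Rightarrow> if m' = m then a t1 else 0 | _ \<Rightarrow> 0)"

definition w_coeff :: "w_scheme \<Rightarrow> tps option \<Rightarrow> real" where
  "w_coeff M = w_step M coeff_fun coeff_mat coeff_y"

definition split_coeff :: "psepirk \<Rightarrow> tps option \<Rightarrow> real" where
  "split_coeff M = psepirk_step M coeff_fun coeff_mat coeff_y"


section \<open>Order\<close>

text \<open>The order condition ranges over all dimensions \<open>d\<close>, so \<open>\<real>\<^sup>d\<close> is the carrier
  \<open>topspace (Euclidean_space d)\<close> of functions \<open>nat \<Rightarrow> real\<close> that vanish from index \<open>d\<close> on.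
  A \<open>d \<times> d\<close> matrix is given by its entries with indices below \<open>d\<close>; other entries are ignored.\<close>

definition mat_vec :: "nat \<Rightarrow> (nat \<Rightarrow> nat \<Rightarrow> real) \<Rightarrow> nat operator" where
  "mat_vec d A v = (\<lambda>i. if i < d then \<Sum>j<d. A i j * v j else 0)"

primrec C_k_on :: "nat \<Rightarrow> nat \<Rightarrow> ((nat \<Rightarrow> real) \<Rightarrow> real) \<Rightarrow> bool" where
  "C_k_on d 0 g \<longleftrightarrow> continuous_map (Euclidean_space d) euclideanreal g"
| "C_k_on d (Suc k) g \<longleftrightarrow> continuous_map (Euclidean_space d) euclideanreal g \<and>
     (\<forall>j<d. \<exists>g'. C_k_on d k g' \<and>
        (\<forall>x\<in>topspace (Euclidean_space d).
           ((\<lambda>t. g (x(j := t))) has_real_derivative g' x) (at (x j))))"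

definition smooth_field :: "nat \<Rightarrow> nat operator \<Rightarrow> bool" where
  "smooth_field d f \<longleftrightarrow>
     f ` topspace (Euclidean_space d) \<subseteq> topspace (Euclidean_space d) \<and>
     (\<forall>i<d. \<forall>k. C_k_on d k (\<lambda>x. f x i))"

definition solves_near :: "nat \<Rightarrow> nat operator \<Rightarrow> real \<Rightarrow> (real \<Rightarrow> nat \<Rightarrow> real) \<Rightarrow> bool" where
  "solves_near d F t0 y \<longleftrightarrow>
     (\<forall>\<^sub>F t in nhds t0. y t \<in> topspace (Euclidean_space d) \<and>
        (\<forall>i<d. ((\<lambda>s. y s i) has_real_derivative F (y t) i) (at t)))"

definition norm_d :: "nat \<Rightarrow> (nat \<Rightarrow> real) \<Rightarrow> real" where
  "norm_d d v = L2_set v {..<d}"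

definition w_has_order :: "w_scheme \<Rightarrow> nat \<Rightarrow> bool" where
  "w_has_order M p \<longleftrightarrow>
     (\<forall>d f W tn y.
        (\<forall>m. smooth_field d (f m)) \<and>
        solves_near d (\<lambda>u i. f C1 u i + f C2 u i) tn y \<longrightarrow>
        (\<lambda>h. norm_d d (\<lambda>i.
           w_step M (\<lambda>m. scale_op h (f m)) (\<lambda>m. scale_op h (mat_vec d (W m))) (y tn) i
             - y (tn + h) i))
          \<in> O[at 0](\<lambda>h. h ^ (p + 1)))"

definition split_has_order :: "psepirk \<Rightarrow> nat \<Rightarrow> bool" where
  "split_has_order M p \<longleftrightarrow>
     (\<forall>d N L tn y.
        (\<forall>m. smooth_field d (N m)) \<and>
        solves_near d (split_hF N (\<lambda>m. mat_vec d (L m))) tn y \<longrightarrow>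
        (\<lambda>h. norm_d d (\<lambda>i.
           psepirk_step M (\<lambda>m. scale_op h (N m)) (\<lambda>m. scale_op h (mat_vec d (L m))) (y tn) i
             - y (tn + h) i))
          \<in> O[at 0](\<lambda>h. h ^ (p + 1)))"

end

theory Submission
  imports Defs
begin

text \<open>
  The idea is to let the coefficient maps themselves be the unknowns of a differential equation.
  Rules (i) and (ii) of the B-series calculus, \<^const>\<open>coeff_fun\<close> and \<^const>\<open>coeff_mat\<close>, compute the
  value at a tree from the values at its immediate subtrees: by a product for a round root, by a
  copy for a square root. Restricted to a finite set \<open>S\<close> of trees that contains the subtrees of its
  members, they are therefore a polynomial vector field and a constant matrix on \<open>\<real>\<^sup>S\<close>, and this is
  an admissible problem for the method, of dimension \<open>card S\<close>.

  For this problem the B-series is exact. Let \<open>embed h a\<close> have the component \<open>h\<^sup>|\<^sup>\<tau>\<^sup>| a(\<tau>)\<close> at the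
  tree \<open>\<tau>\<close>. Then \<open>embed h\<close> turns \<^const>\<open>coeff_fun\<close> and \<^const>\<open>coeff_mat\<close> into \<open>h\<close> times the
  vector field and \<open>h\<close> times the matrix (\<open>tree_field_embed\<close>, \<open>tree_matrix_embed\<close>), since the size of
  a tree exceeds the total size of the subtrees of its root by one. A step of the method is built
  from these operators by pointwise linear combinations and by matrix functions, so it commutes
  with \<open>embed h\<close> (\<open>w_step_T\<close>, \<open>psepirk_step_T\<close>): started at \<open>embed h coeff_y\<close>, a point that is the
  same for all \<open>h\<close>, the numerical solution is exactly \<open>embed h\<close> of its coefficient map. The exact
  solution at time \<open>h\<close> is \<open>embed h\<close> of the map \<open>1/\<gamma>\<close>, because the differential equation for the
  component \<open>b(\<tau>) t\<^sup>|\<^sup>\<tau>\<^sup>|\<close> is the recursion \<open>|\<tau>| b(\<tau>) = b(\<tau>\<^sub>1) \<cdots> b(\<tau>\<^sub>k)\<close> that defines the density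
  (\<open>exact_coeff_W\<close>, \<open>exact_coeff_S\<close>). In the W setting the matrices are absent from the differential
  equation, so the components at trees with a square node stay zero.

  The component at \<open>\<tau>\<close> of the error after one step is thus \<open>h\<^sup>|\<^sup>\<tau>\<^sup>|\<close> times the difference of the two
  coefficients. If \<open>|\<tau>| \<le> p\<close>, order \<open>p\<close> forces this difference to vanish
  (\<open>coefficient_eq_if_embed_bigo\<close>).
\<close>

section \<open>Trees\<close>

definition osize :: "tps option \<Rightarrow> nat" where
  "osize t = (case t of None \<Rightarrow> 0 | Some \<tau> \<Rightarrow> tsize \<tau>)"

lemma osize_simps [simp]: "osize None = 0" "osize (Some \<tau>) = tsize \<tau>"
  by (simp_all add: osize_def)

lemma tsize_Square [simp]: "tsize (Square m t) = Suc (osize t)"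
  by (cases t) simp_all

declare tsize.simps(2) [simp del]

lemma tsize_pos [simp]: "tsize \<tau> > 0" and tsize_neq_0 [simp]: "tsize \<tau> \<noteq> 0"
  by (cases \<tau>; simp)+

definition subtree_closed :: "tps option set \<Rightarrow> bool" where
  "subtree_closed S \<longleftrightarrow>
     (\<forall>m ts t. Some (Round m ts) \<in> S \<longrightarrow> t \<in># ts \<longrightarrow> Some t \<in> S) \<and>
     (\<forall>m t. Some (Square m t) \<in> S \<longrightarrow> t \<in> S)"

lemma subtree_closed_UN:
  assumes "\<And>i. i \<in> I \<Longrightarrow> subtree_closed (S i)"
  shows "subtree_closed (\<Union>i\<in>I. S i)"
  unfolding subtree_closed_def
proof (intro conjI allI impI)
  fix m ts t assume "Some (Round m ts) \<in> (\<Union>i\<in>I. S i)" and t: "t \<in># ts"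
  then obtain i where i: "i \<in> I" "Some (Round m ts) \<in> S i" by blast
  from assms[OF i(1)] i t show "Some t \<in> (\<Union>i\<in>I. S i)"
    unfolding subtree_closed_def by blast
next
  fix m t assume "Some (Square m t) \<in> (\<Union>i\<in>I. S i)"
  then obtain i where i: "i \<in> I" "Some (Square m t) \<in> S i" by blast
  from assms[OF i(1)] i show "t \<in> (\<Union>i\<in>I. S i)"
    unfolding subtree_closed_def by blast
qed

lemma subtree_closed_insert:
  assumes U: "subtree_closed U"
    and Round: "\<And>m ts t. \<tau> = Round m ts \<Longrightarrow> t \<in># ts \<Longrightarrow> Some t \<in> U"
    and Square: "\<And>m t. \<tau> = Square m t \<Longrightarrow> t \<in> U"
  shows "subtree_closed (insert (Some \<tau>) U)"
  unfolding subtree_closed_def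
proof (intro conjI allI impI)
  fix m ts t assume *: "Some (Round m ts) \<in> insert (Some \<tau>) U" "t \<in># ts"
  have "Some t \<in> U"
  proof (cases "\<tau> = Round m ts")
    case False
    with * have "Some (Round m ts) \<in> U" by simp
    then show ?thesis using U *(2) unfolding subtree_closed_def by blast
  qed (rule Round[OF _ *(2)])
  then show "Some t \<in> insert (Some \<tau>) U" by simp
next
  fix m t assume *: "Some (Square m t) \<in> insert (Some \<tau>) U"
  have "t \<in> U"
  proof (cases "\<tau> = Square m t")
    case False
    with * have "Some (Square m t) \<in> U" by simp
    then show ?thesis using U unfolding subtree_closed_def by blast
  qed (rule Square)
  then show "t \<in> insert (Some \<tau>) U" by simp
qed

text \<open>This provides the finitely many components of the test problem for a given tree.\<close>

lemma finite_subtree_closed_superset: "\<exists>S. finite S \<and> subtree_closed S \<and> Some \<tau> \<in> S"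
proof (induction \<tau>)
  case (Round m ts)
  then obtain S where S: "\<And>t. t \<in># ts \<Longrightarrow> finite (S t)"
    "\<And>t. t \<in># ts \<Longrightarrow> subtree_closed (S t)" "\<And>t. t \<in># ts \<Longrightarrow> Some t \<in> S t"
    by metis
  let ?U = "\<Union>t\<in>set_mset ts. S t"
  have "subtree_closed (insert (Some (Round m ts)) ?U)"
    by (intro subtree_closed_insert subtree_closed_UN S(2)) (use S(3) in auto)
  moreover have "finite ?U" using S(1) by simp
  ultimately show ?case by blast
next
  case (Square m t)
  have "\<exists>S. finite S \<and> subtree_closed S \<and> t \<in> S"
  proof (cases t)
    case None
    have "subtree_closed {None}" by (simp add: subtree_closed_def)
    with None show ?thesis by blast
  next
    case (Some \<tau>)
    with Square show ?thesis by simp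
  qed
  then obtain S where "finite S" "subtree_closed S" "t \<in> S" by blast
  moreover from this have "subtree_closed (insert (Some (Square m t)) S)"
    by (intro subtree_closed_insert) simp_all
  ultimately show ?case by blast
qed

section \<open>Transporting a step along a weighted reindexing\<close>

definition reindex :: "('z \<Rightarrow> real) \<Rightarrow> ('z \<Rightarrow> 'x) \<Rightarrow> ('x \<Rightarrow> real) \<Rightarrow> 'z \<Rightarrow> real" where
  "reindex w s a = (\<lambda>z. w z * a (s z))"

text \<open>
  A method is executed on two spaces of functions, with operators \<open>hf\<close>, \<open>hA\<close> on the first and
  \<open>hf'\<close>, \<open>hA'\<close> on the second. Reindexing with weights is compatible with all pointwise linear
  combinations, so it commutes with everything that a method computes as soon as it intertwines
  these operators. The only limit process is the series of \<^const>\<open>phi_op\<close>; it is a finite sum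
  because the operators \<open>hA\<close> are assumed to be locally nilpotent.
\<close>

locale operator_morphism =
  fixes w :: "'z \<Rightarrow> real" and s :: "'z \<Rightarrow> 'x"
    and hf hA :: "color \<Rightarrow> 'x operator" and hf' hA' :: "color \<Rightarrow> 'z operator"
  assumes hf: "hf' m (reindex w s a) = reindex w s (hf m a)"
    and hA: "hA' m (reindex w s a) = reindex w s (hA m a)"
    and nilpotent: "\<exists>n. \<forall>i\<ge>n. (scale_op c (hA m) ^^ i) a x = 0"
begin

abbreviation (input) T :: "('x \<Rightarrow> real) \<Rightarrow> 'z \<Rightarrow> real" where
  "T \<equiv> reindex w s"

lemma phi_op_T: "phi_op k (scale_op c (hA' m)) (T a) = T (phi_op k (scale_op c (hA m)) a)"
proof
  fix z
  have pow: "(scale_op c (hA' m) ^^ i) (T a) = T ((scale_op c (hA m) ^^ i) a)" for i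
  proof (induction i)
    case (Suc i)
    then show ?case by (simp add: scale_op_def hA) (simp add: reindex_def mult.left_commute)
  qed simp
  obtain n where n: "\<And>i. i \<ge> n \<Longrightarrow> (scale_op c (hA m) ^^ i) a (s z) = 0"
    using nilpotent by blast
  have "summable (\<lambda>i. (scale_op c (hA m) ^^ i) a (s z) / fact (k + i))"
    by (rule summable_finite[of "{..<n}"]) (use n in \<open>auto simp: not_less\<close>)
  from suminf_mult[OF this, of "w z"]
  show "phi_op k (scale_op c (hA' m)) (T a) z = T (phi_op k (scale_op c (hA m)) a) z"
    by (simp add: phi_op_def pow) (simp add: reindex_def)
qed

lemma psi_op_T: "psi_op p j (scale_op c (hA' m)) (T a) = T (psi_op p j (scale_op c (hA m)) a)"
  by (simp add: psi_op_def phi_op_T) (simp add: reindex_def sum_distrib_left mult.left_commute)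

text \<open>The nodes are compared only up to the last one that occurs in the difference, so that the
  lemma applies inside the inductions over the stages.\<close>

lemma fdiff_T:
  assumes "\<And>a. G' (T a) = T (G a)" and "\<And>l. l \<le> i + j \<Longrightarrow> Y' l = T (Y l)"
  shows "fdiff j G' Y' i = T (fdiff j G Y i)"
  using assms(2)
proof (induction j arbitrary: i)
  case (Suc j)
  then have "fdiff j G' Y' i = T (fdiff j G Y i)"
    "fdiff j G' Y' (Suc i) = T (fdiff j G Y (Suc i))" by auto
  then show ?case by (simp add: reindex_def right_diff_distrib)
qed (simp add: assms(1))

lemma pexpw_k_T: "pexpw_k M hf' hA' (T y) i q = T (pexpw_k M hf hA y i q)"
proof (induction i arbitrary: q rule: less_induct)
  case (less i)
  \<comment> \<open>the arguments of \<open>hf\<close> and \<open>hA\<close> in the formula for the stage\<close>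
  define U where "U = (\<lambda>x. y x + (\<Sum>m\<in>{C1, C2}. \<Sum>j=1..min (i - 1) (w_s M m).
      w_alpha M q m i j * pexpw_k M hf hA y j m x))"
  define V where "V = (\<lambda>x. \<Sum>m\<in>{C1, C2}. \<Sum>j=1..min (i - 1) (w_s M m).
      w_gamma M q m i j * pexpw_k M hf hA y j m x)"
  have IH: "(\<Sum>j=1..min (i - 1) (w_s M m). c j * pexpw_k M hf' hA' (T y) j m z)
      = w z * (\<Sum>j=1..min (i - 1) (w_s M m). c j * pexpw_k M hf hA y j m (s z))" for c m z
    unfolding sum_distrib_left
  proof (rule sum.cong)
    fix j assume "j \<in> {1..min (i - 1) (w_s M m)}"
    then have "j < i" by auto
    then show "c j * pexpw_k M hf' hA' (T y) j m z = w z * (c j * pexpw_k M hf hA y j m (s z))"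
      by (simp add: less) (simp add: reindex_def)
  qed simp
  have U: "(\<lambda>z. T y z + (\<Sum>m\<in>{C1, C2}. \<Sum>j=1..min (i - 1) (w_s M m).
      w_alpha M q m i j * pexpw_k M hf' hA' (T y) j m z)) = T U"
    by (simp only: IH) (simp add: reindex_def U_def distrib_left)
  have V: "(\<lambda>z. \<Sum>m\<in>{C1, C2}. \<Sum>j=1..min (i - 1) (w_s M m).
      w_gamma M q m i j * pexpw_k M hf' hA' (T y) j m z) = T V"
    by (simp only: IH) (simp add: reindex_def V_def distrib_left)
  have "pexpw_k M hf' hA' (T y) i q =
      phi_op 1 (scale_op (w_gamma M q q i i) (hA' q)) (\<lambda>z. hf' q (T U) z + hA' q (T V) z)"
    unfolding U[symmetric] V[symmetric] by (rule pexpw_k.simps)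
  also have "(\<lambda>z. hf' q (T U) z + hA' q (T V) z) = T (\<lambda>x. hf q U x + hA q V x)"
    by (simp add: hf hA) (simp add: reindex_def distrib_left)
  finally show ?case
    unfolding phi_op_T U_def V_def by (simp only: pexpw_k.simps[of M hf hA y i q])
qed

lemma pexpw_step_T: "pexpw_step M hf' hA' (T y) = T (pexpw_step M hf hA y)"
  by (simp add: pexpw_step_def pexpw_k_T)
    (simp add: reindex_def distrib_left sum_distrib_left mult.left_commute)

lemma pepirkw_Y_T: "pepirkw_Y M hf' hA' (T y) q i = T (pepirkw_Y M hf hA y q i)"
proof (induction i rule: less_induct)
  case (less i)
  have S: "(\<Sum>j=2..n. c j * psi_op (p j) j (scale_op (g j) (hA' m))
        (fdiff (j - 1) (hf' m) (pepirkw_Y M hf' hA' (T y) q) 0) z)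
      = w z * (\<Sum>j=2..n. c j * psi_op (p j) j (scale_op (g j) (hA m))
        (fdiff (j - 1) (hf m) (pepirkw_Y M hf hA y q) 0) (s z))"
    if "n \<le> i" for n c p g m z
    unfolding sum_distrib_left
  proof (rule sum.cong)
    fix j assume j: "j \<in> {2..n}"
    have "fdiff (j - 1) (hf' m) (pepirkw_Y M hf' hA' (T y) q) 0
        = T (fdiff (j - 1) (hf m) (pepirkw_Y M hf hA y q) 0)"
    proof (rule fdiff_T[where G = "hf m"
          and G' = "hf' m", OF hf])
      fix l assume "l \<le> 0 + (j - 1)"
      with j that have "l < i" by auto
      then show "pepirkw_Y M hf' hA' (T y) q l = T (pepirkw_Y M hf hA y q l)" by (rule less)
    qed
    then show "c j * psi_op (p j) j (scale_op (g j) (hA' m))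
          (fdiff (j - 1) (hf' m) (pepirkw_Y M hf' hA' (T y) q) 0) z
        = w z * (c j * psi_op (p j) j (scale_op (g j) (hA m))
          (fdiff (j - 1) (hf m) (pepirkw_Y M hf hA y q) 0) (s z))"
      by (simp only: psi_op_T) (simp add: reindex_def)
  qed simp
  show ?case
  proof (cases "i = 0")
    case False
    then show ?thesis
      unfolding pepirkw_Y.simps[of M _ _ _ _ i]
      by (simp only: if_False S min.cobounded2 order_refl hf psi_op_T)
        (simp add: reindex_def distrib_left mult.left_commute)
  qed (simp add: pepirkw_Y.simps[of M _ _ _ _ 0])
qed

lemma pepirkw_step_T: "pepirkw_step M hf' hA' (T y) = T (pepirkw_step M hf hA y)"
  by (simp add: pepirkw_step_def hf psi_op_T
      fdiff_T[where G = "hf m" and G' = "hf' m" for m, OF hf pepirkw_Y_T])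
    (simp add: reindex_def distrib_left sum_distrib_left mult.left_commute)

lemma w_step_T: "w_step M hf' hA' (T y) = T (w_step M hf hA y)"
  by (cases M) (simp_all add: pexpw_step_T pepirkw_step_T)

lemma split_hF_T: "split_hF hf' hA' (T a) = T (split_hF hf hA a)"
  by (simp add: split_hF_def split_hf_def hf hA) (simp add: reindex_def distrib_left)

lemma split_hG_T: "split_hG hf' hA' m (T a) = T (split_hG hf hA m a)"
  by (simp add: split_hG_def split_hf_def hf hA) (simp add: reindex_def distrib_left)

lemma psepirk_Y_T: "psepirk_Y M hf' hA' (T y) i = T (psepirk_Y M hf hA y i)"
proof (induction i rule: less_induct)
  case (less i)
  have S: "(\<Sum>j=2..n. c j * psi_op (p j) j (scale_op (g j) (hA' m))
        (fdiff (j - 1) (split_hG hf' hA' m) (psepirk_Y M hf' hA' (T y)) 0) z)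
      = w z * (\<Sum>j=2..n. c j * psi_op (p j) j (scale_op (g j) (hA m))
        (fdiff (j - 1) (split_hG hf hA m) (psepirk_Y M hf hA y) 0) (s z))"
    if "n \<le> i" for n c p g m z
    unfolding sum_distrib_left
  proof (rule sum.cong)
    fix j assume j: "j \<in> {2..n}"
    have "fdiff (j - 1) (split_hG hf' hA' m) (psepirk_Y M hf' hA' (T y)) 0
        = T (fdiff (j - 1) (split_hG hf hA m) (psepirk_Y M hf hA y) 0)"
    proof (rule fdiff_T[where G = "split_hG hf hA m"
          and G' = "split_hG hf' hA' m", OF split_hG_T])
      fix l assume "l \<le> 0 + (j - 1)"
      with j that have "l < i" by auto
      then show "psepirk_Y M hf' hA' (T y) l = T (psepirk_Y M hf hA y l)" by (rule less)
    qed
    then show "c j * psi_op (p j) j (scale_op (g j) (hA' m))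
          (fdiff (j - 1) (split_hG hf' hA' m) (psepirk_Y M hf' hA' (T y)) 0) z
        = w z * (c j * psi_op (p j) j (scale_op (g j) (hA m))
          (fdiff (j - 1) (split_hG hf hA m) (psepirk_Y M hf hA y) 0) (s z))"
      by (simp only: psi_op_T) (simp add: reindex_def)
  qed simp
  show ?case
  proof (cases "i = 0")
    case False
    then show ?thesis
      unfolding psepirk_Y.simps[of M _ _ _ i]
      by (simp only: if_False S min.cobounded2 order_refl split_hF_T psi_op_T)
        (simp add: reindex_def distrib_left mult.left_commute)
  qed (simp add: psepirk_Y.simps[of M _ _ _ 0])
qed

lemma psepirk_step_T: "psepirk_step M hf' hA' (T y) = T (psepirk_step M hf hA y)"
  by (simp add: psepirk_step_def 
      fdiff_T[where G = "split_hG hf hA m" and G' = "split_hG hf' hA' m" for m,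
        OF split_hG_T psepirk_Y_T] split_hF_T psi_op_T)
    (simp add: reindex_def distrib_left sum_distrib_left mult.left_commute)

end

section \<open>Smoothness of monomials\<close>

text \<open>Monomials in the coordinates, given by the multiset of the indices of their factors. With a
  constant factor, they form a class of functions that is closed under partial derivatives.\<close>

lemma has_real_derivative_prod_mset_fun_upd:
  fixes x :: "nat \<Rightarrow> real"
  shows "((\<lambda>t. prod_mset (image_mset (x(j := t)) B)) has_real_derivative
    real (count B j) * prod_mset (image_mset x (B - {#j#}))) (at (x j))"
proof (induction B)
  case empty
  show ?case by simp
next
  case (add a B)
  have a: "((\<lambda>t. (x(j := t)) a) has_real_derivative (if a = j then 1 else 0)) (at (x j))"
    by (auto intro!: derivative_eq_intros)
  have "x j * (real (count B j) * prod_mset (image_mset x (B - {#j#})))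
      = real (count B j) * prod_mset (image_mset x B)"
  proof (cases "j \<in># B")
    case True
    then obtain B' where "B = add_mset j B'" by (metis insert_DiffM)
    then show ?thesis by simp
  qed (simp add: not_in_iff)
  moreover have "real (count B j) * prod_mset (image_mset x (add_mset a B - {#j#}))
      = x a * (real (count B j) * prod_mset (image_mset x (B - {#j#})))" if "a \<noteq> j"
    using that by (simp add: add_mset_diff_bothsides)
  ultimately have "(if a = j then 1 else 0) * prod_mset (image_mset (x(j := x j)) B)
      + real (count B j) * prod_mset (image_mset x (B - {#j#})) * (x(j := x j)) a
      = real (count (add_mset a B) j) * prod_mset (image_mset x (add_mset a B - {#j#}))"
    by (cases "a = j") (simp_all add: algebra_simps)
  with DERIV_mult[OF a add] show ?case
    unfolding image_mset_add_mset prod_mset.add_mset by (rule DERIV_cong)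
qed

lemma C_k_on_monomial: "C_k_on d k (\<lambda>x. c * prod_mset (image_mset x B))"
proof (induction k arbitrary: c B)
  case 0
  have "continuous_map (Euclidean_space d) euclideanreal (\<lambda>x. prod_mset (image_mset x B))"
  proof (induction B)
    case (add a B)
    have "continuous_map (Euclidean_space d) euclideanreal (\<lambda>x. x a)"
      unfolding Euclidean_space_def
      by (intro continuous_map_from_subtopology continuous_map_product_projection) simp
    with add show ?case by (simp add: continuous_map_real_mult)
  qed simp
  then show ?case by (simp add: continuous_map_real_mult_left)
next
  case (Suc k)
  have cont: "continuous_map (Euclidean_space d) euclideanreal (\<lambda>x. c * prod_mset (image_mset x B))"
    using Suc[of c B] by (cases k) simp_all
  show ?case
  proof (simp only: C_k_on.simps, intro conjI allI impI cont)
    fix j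
    show "\<exists>g'. C_k_on d k g' \<and> (\<forall>x\<in>topspace (Euclidean_space d).
        ((\<lambda>t. c * prod_mset (image_mset (x(j := t)) B)) has_real_derivative g' x) (at (x j)))"
    proof (intro exI conjI ballI)
      show "C_k_on d k (\<lambda>x. (c * real (count B j)) * prod_mset (image_mset x (B - {#j#})))"
        by (rule Suc)
      show "((\<lambda>t. c * prod_mset (image_mset (x(j := t)) B)) has_real_derivative
          (c * real (count B j)) * prod_mset (image_mset x (B - {#j#}))) (at (x j))" for x
        unfolding mult.assoc by (rule DERIV_cmult[OF has_real_derivative_prod_mset_fun_upd])
    qed
  qed
qed

section \<open>The universal test problem\<close>

text \<open>The empty tree has size \<open>0\<close>, where \<open>osize t - 1\<close> is not the predecessor; there both rules
  give the coefficient \<open>0\<close>.\<close>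

lemma step_size_times_power:
  "h * (h ^ (osize t - 1) * coeff_fun m a t) = h ^ osize t * coeff_fun m a t"
  "h * (h ^ (osize t - 1) * coeff_mat m a t) = h ^ osize t * coeff_mat m a t"
proof -
  have "osize t = Suc (osize t - 1)" if "t \<noteq> None"
    using that by (cases t) auto
  then have "h * h ^ (osize t - 1) = h ^ osize t" if "t \<noteq> None"
    using that by (metis power_Suc)
  then show "h * (h ^ (osize t - 1) * coeff_fun m a t) = h ^ osize t * coeff_fun m a t"
    "h * (h ^ (osize t - 1) * coeff_mat m a t) = h ^ osize t * coeff_mat m a t"
    by (cases "t = None"; simp add: coeff_fun_def coeff_mat_def flip: mult.assoc)+
qed

text \<open>Every application of the matrix rule strips one square node from the tree.\<close>

lemma coeff_mat_nilpotent: "\<exists>n. \<forall>i\<ge>n. (scale_op c (coeff_mat m) ^^ i) a t = 0"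
proof -
  have "(scale_op c (coeff_mat m) ^^ i) a t = 0" if "osize t < i" for i
    using that
  proof (induction i arbitrary: t)
    case (Suc i)
    then show ?case
      by (auto simp: scale_op_def coeff_mat_def tsize_Square split: option.split tps.split)
  qed simp
  then show ?thesis by (meson less_eq_Suc_le)
qed

text \<open>The components of the test problem are numbered by \<open>s\<close>. They belong to trees, possibly
  including the empty tree, whose component is constant.\<close>

locale tree_coordinates =
  fixes d :: nat and s :: "nat \<Rightarrow> tps option"
  assumes inj: "inj_on s {..<d}"
    and closed: "subtree_closed (s ` {..<d})"
begin

definition idx :: "tps option \<Rightarrow> nat" where
  "idx = inv_into {..<d} s"

text \<open>The vector field and the matrix are the rules (i) and (ii) themselves, read in coordinates:
  in a closed index set, these only inspect trees that have an index.\<close>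

definition tree_field :: "color \<Rightarrow> nat operator" where
  "tree_field m u i = (if i < d then coeff_fun m (\<lambda>t. u (idx t)) (s i) else 0)"

definition tree_matrix :: "color \<Rightarrow> nat \<Rightarrow> nat \<Rightarrow> real" where
  "tree_matrix m i j = coeff_mat m (\<lambda>t. if t = s j then 1 else 0) (s i)"

text \<open>The summand of a B-series that belongs to a tree carries the power of \<open>h\<close> given by its
  size. At \<open>coeff_y\<close>, the elementary differential of a tree \<open>\<tau>\<close> of the test problem vanishes in
  all components except that of \<open>\<tau>\<close>, where it is \<open>\<sigma>(\<tau>)\<close>, so the B-series there is \<open>embed\<close>.\<close>

definition weight :: "real \<Rightarrow> nat \<Rightarrow> real" where
  "weight h i = (if i < d then h ^ osize (s i) else 0)"

abbreviation (input) embed :: "real \<Rightarrow> (tps option \<Rightarrow> real) \<Rightarrow> nat \<Rightarrow> real" where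
  "embed h \<equiv> reindex (weight h) s"

lemma embed_apply: "embed h a i = (if i < d then h ^ osize (s i) * a (s i) else 0)"
  by (simp add: reindex_def weight_def)

lemma idx: "idx t < d \<and> s (idx t) = t" if "t \<in> s ` {..<d}"
  using inv_into_into[OF that] f_inv_into_f[OF that] by (simp add: idx_def)

lemma embed_idx: "embed h a (idx t) = h ^ osize t * a t" if "t \<in> s ` {..<d}"
  using idx[OF that] by (simp add: embed_apply)

text \<open>The rules hold without a remainder: the exponents of the subtrees add up to one less than the
  size of the tree. The missing factor \<open>h\<close> is the one by which the operators of the method are
  scaled. Stating the lemmas without it makes them valid for \<open>h = 0\<close>, which the differential
  equation of the exact solution needs.\<close>

lemma tree_field_embed:
  assumes "i < d"
  shows "tree_field m (embed h a) i = h ^ (osize (s i) - 1) * coeff_fun m a (s i)"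
proof (cases "\<exists>ts. s i = Some (Round m ts)")
  case True
  then obtain ts where ts: "s i = Some (Round m ts)" by blast
  have mem: "Some t \<in> s ` {..<d}" if "t \<in># ts" for t
    using closed assms ts that unfolding subtree_closed_def by (metis imageI lessThan_iff)
  have "tree_field m (embed h a) i = (\<Prod>t\<in>#ts. embed h a (idx (Some t)))"
    using assms by (simp add: tree_field_def coeff_fun_def ts)
  also have "\<dots> = (\<Prod>t\<in>#ts. h ^ tsize t * a (Some t))"
    by (rule arg_cong[of _ _ prod_mset], rule image_mset_cong) (simp add: embed_idx mem)
  also have "\<dots> = h ^ (\<Sum>t\<in>#ts. tsize t) * (\<Prod>t\<in>#ts. a (Some t))"
    by (induction ts) (simp_all add: power_add)
  finally show ?thesis by (simp add: coeff_fun_def ts)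
qed (use assms in \<open>auto simp: tree_field_def coeff_fun_def split: option.splits tps.splits\<close>)

lemma tree_matrix_embed:
  assumes "i < d"
  shows "mat_vec d (tree_matrix m) (embed h a) i = h ^ (osize (s i) - 1) * coeff_mat m a (s i)"
proof (cases "\<exists>t. s i = Some (Square m t)")
  case True
  then obtain t where t: "s i = Some (Square m t)" by blast
  have mem: "t \<in> s ` {..<d}"
    using closed assms t unfolding subtree_closed_def by (metis imageI lessThan_iff)
  have "mat_vec d (tree_matrix m) (embed h a) i
      = (\<Sum>j<d. (if t = s j then 1 else 0) * embed h a j)"
    using assms by (simp add: mat_vec_def tree_matrix_def coeff_mat_def t)
  also have "\<dots> = (\<Sum>j<d. if idx t = j then embed h a j else 0)"
    using idx[OF mem] inj by (intro sum.cong) (auto dest: inj_onD)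
  also have "\<dots> = embed h a (idx t)"
    using idx[OF mem] by (simp add: sum.delta')
  finally show ?thesis by (simp add: embed_idx[OF mem] coeff_mat_def t tsize_Square)
qed (use assms in \<open>auto simp: mat_vec_def tree_matrix_def coeff_mat_def
    split: option.splits tps.splits\<close>)

sublocale operator_morphism "weight h" s
  coeff_fun coeff_mat "\<lambda>m. scale_op h (tree_field m)"
  "\<lambda>m. scale_op h (mat_vec d (tree_matrix m))" for h
proof
  fix m a i
  show "scale_op h (tree_field m) (embed h a) = embed h (coeff_fun m a)"
  proof
    fix i
    show "scale_op h (tree_field m) (embed h a) i = embed h (coeff_fun m a) i"
    proof (cases "i < d")
      case True
      then show ?thesis
        unfolding scale_op_def tree_field_embed[OF True] step_size_times_power by (simp add: embed_apply)
    qed (simp add: scale_op_def tree_field_def embed_apply)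
  qed
  show "scale_op h (mat_vec d (tree_matrix m)) (embed h a) = embed h (coeff_mat m a)"
  proof
    fix i
    show "scale_op h (mat_vec d (tree_matrix m)) (embed h a) i = embed h (coeff_mat m a) i"
    proof (cases "i < d")
      case True
      then show ?thesis
        unfolding scale_op_def tree_matrix_embed[OF True] step_size_times_power
        by (simp add: embed_apply)
    qed (simp add: scale_op_def mat_vec_def embed_apply)
  qed
qed (rule coeff_mat_nilpotent)

lemma smooth_tree_field: "smooth_field d (tree_field m)"
  unfolding smooth_field_def
proof (intro conjI allI impI)
  show "tree_field m ` topspace (Euclidean_space d) \<subseteq> topspace (Euclidean_space d)"
    by (auto simp: topspace_Euclidean_space tree_field_def)
next
  fix i k assume "i < d"
  show "C_k_on d k (\<lambda>x. tree_field m x i)"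
  proof (cases "\<exists>ts. s i = Some (Round m ts)")
    case True
    then obtain ts where "s i = Some (Round m ts)" by blast
    then have "(\<lambda>x. tree_field m x i)
        = (\<lambda>x. 1 * prod_mset (image_mset x (image_mset (\<lambda>t. idx (Some t)) ts)))"
      using \<open>i < d\<close> by (simp add: tree_field_def coeff_fun_def image_mset.compositionality comp_def)
    then show ?thesis by (simp only: C_k_on_monomial)
  next
    case False
    then have "(\<lambda>x. tree_field m x i) = (\<lambda>x. 0 * prod_mset (image_mset x {#}))"
      by (auto simp: tree_field_def coeff_fun_def fun_eq_iff split: option.splits tps.splits)
    then show ?thesis by (simp only: C_k_on_monomial)
  qed
qed

text \<open>For \<open>F\<close> as in the hypothesis, the differential equation for the component \<open>b(\<tau>) t\<^sup>|\<^sup>\<tau>\<^sup>|\<close> is the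
  power rule.\<close>

lemma embed_solves:
  fixes b :: "tps option \<Rightarrow> real"
  assumes "\<And>t i. i < d \<Longrightarrow> F (embed t b) i = t ^ (osize (s i) - 1) * (osize (s i) * b (s i))"
  shows "solves_near d F 0 (\<lambda>t. embed t b)"
  unfolding solves_near_def
proof (intro always_eventually allI conjI impI)
  fix t
  show "embed t b \<in> topspace (Euclidean_space d)"
    by (simp add: topspace_Euclidean_space embed_apply)
  fix i assume "i < d"
  then show "((\<lambda>t. embed t b i) has_real_derivative F (embed t b) i) (at t)"
    unfolding assms[OF \<open>i < d\<close>] by (auto simp: embed_apply intro!: derivative_eq_intros)
qed

text \<open>The exact solution at time \<open>0\<close> is the starting point of the numerical solution for every
  step size, as only the component of the empty tree is nonzero there.\<close>

lemma embed_initial: "b None = 1 \<Longrightarrow> embed 0 b = embed h coeff_y"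
  by (auto simp: embed_apply coeff_y_def fun_eq_iff osize_def power_0_left
      split: option.split)

text \<open>Coefficients can be read off from \<open>embed\<close>: a term \<open>c h\<^sup>|\<^sup>t\<^sup>|\<close> with \<open>|t| \<le> p\<close> is \<open>O(h\<^sup>p\<^sup>+\<^sup>1)\<close> only if
  \<open>c = 0\<close>.\<close>

lemma coefficient_eq_if_embed_bigo:
  assumes O: "(\<lambda>h. norm_d d (\<lambda>i. embed h a i - embed h b i)) \<in> O[at 0](\<lambda>h. h ^ (p + 1))"
    and t: "t \<in> s ` {..<d}" "osize t \<le> p"
  shows "a t = b t"
proof (rule ccontr)
  assume neq: "a t \<noteq> b t"
  obtain i where i: "i < d" "s i = t" using t by auto
  obtain C where C: "eventually (\<lambda>h. norm (norm_d d (\<lambda>i. embed h a i - embed h b i))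
      \<le> C * norm (h ^ (p + 1))) (at (0::real))"
    using O by (elim landau_o.bigE)
  have "eventually (\<lambda>h. \<bar>a t - b t\<bar> \<le> C * \<bar>h\<bar> ^ (p + 1 - osize t)) (at (0::real))"
    using C eventually_neq_at_within[of 0]
  proof eventually_elim
    case (elim h)
    have "\<bar>h\<bar> ^ osize t * \<bar>a t - b t\<bar> = \<bar>embed h a i - embed h b i\<bar>"
      using i by (simp add: embed_apply abs_mult power_abs flip: right_diff_distrib)
    also have "\<dots> \<le> norm_d d (\<lambda>i. embed h a i - embed h b i)"
      unfolding norm_d_def using i
      by (metis (no_types, lifting) L2_set_def finite_lessThan lessThan_iff member_le_sum
          real_sqrt_abs real_sqrt_le_mono zero_le_power2)
    also have "\<dots> \<le> C * \<bar>h\<bar> ^ (p + 1)" using elim by (simp add: power_abs abs_mult)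
    also have "\<bar>h\<bar> ^ (p + 1) = \<bar>h\<bar> ^ osize t * \<bar>h\<bar> ^ (p + 1 - osize t)"
      using t by (simp flip: power_add)
    finally have "\<bar>h\<bar> ^ osize t * \<bar>a t - b t\<bar> \<le> \<bar>h\<bar> ^ osize t * (C * \<bar>h\<bar> ^ (p + 1 - osize t))"
      by (simp add: mult_ac)
    then show ?case using elim by (simp add: mult_le_cancel_left_pos)
  qed
  moreover have "((\<lambda>h::real. C * \<bar>h\<bar> ^ (p + 1 - osize t)) \<longlongrightarrow> 0) (at 0)"
    using t by (auto intro!: tendsto_eq_intros)
  ultimately have "\<bar>a t - b t\<bar> \<le> 0"
    by (intro tendsto_lowerbound) auto
  with neq show False by simp
qed

end

lemma obtain_tree_coordinates:
  obtains d s where "tree_coordinates d s" "Some \<tau> \<in> s ` {..<d}"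
proof -
  obtain S where S: "finite S" "subtree_closed S" "Some \<tau> \<in> S"
    using finite_subtree_closed_superset by blast
  obtain s where "bij_betw s {0..<card S} S"
    using ex_bij_betw_nat_finite[OF S(1)] by blast
  then have s: "inj_on s {..<card S}" "s ` {..<card S} = S"
    by (auto simp: bij_betw_def atLeast0LessThan)
  show thesis
    by (rule that[of "card S" s]) (unfold_locales, use S(2,3) s in simp_all)
qed

section \<open>The exact solution\<close>

definition exact_coeff :: "(tps \<Rightarrow> real) \<Rightarrow> tps option \<Rightarrow> real" where
  "exact_coeff g t = (case t of None \<Rightarrow> 1 | Some \<tau> \<Rightarrow> g \<tau>)"

lemma inv_gamma_W_Round:
  "real (tsize (Round m ts)) * inv_gamma_W (Round m ts) = (\<Prod>t\<in>#ts. inv_gamma_W t)"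
proof -
  have "(\<Prod>t\<in>#ts. inv_gamma_W t) = (if \<exists>t\<in>#ts. has_square t then 0
      else 1 / real (\<Prod>t\<in>#ts. density t))"
    by (induction ts) (simp_all add: inv_gamma_W_def)
  then show ?thesis by (simp add: inv_gamma_W_def image_iff del: tsize.simps)
qed

lemma inv_gamma_S_Round:
  "real (tsize (Round m ts)) * inv_gamma_S (Round m ts) = (\<Prod>t\<in>#ts. inv_gamma_S t)"
proof -
  have "(\<Prod>t\<in>#ts. inv_gamma_S t) = 1 / real (\<Prod>t\<in>#ts. density t)"
    by (induction ts) (simp_all add: inv_gamma_S_def)
  then show ?thesis by (simp add: inv_gamma_S_def del: tsize.simps)
qed

lemma inv_gamma_S_Square:
  "real (tsize (Square m t)) * inv_gamma_S (Square m t) = exact_coeff inv_gamma_S t"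
  by (cases t) (simp_all add: inv_gamma_S_def exact_coeff_def del: tsize_Square)

text \<open>The recursion of the density, as a fixed point equation for the rules: applying the right-hand
  side of the differential equation to the exact coefficients multiplies each of them by the size
  of its tree. On the square trees, the rule (ii) is present only for the split right-hand side.\<close>

lemma exact_coeff_W:
  fixes b :: "tps option \<Rightarrow> real" defines "b \<equiv> exact_coeff inv_gamma_W"
  shows "coeff_fun C1 b t + coeff_fun C2 b t = osize t * b t"
proof (cases t)
  case (Some \<tau>)
  then show ?thesis
  proof (cases \<tau>)
    case (Round m ts)
    then show ?thesis using inv_gamma_W_Round[of m ts] Some
      by (cases m) (simp_all add: coeff_fun_def b_def exact_coeff_def)
  qed (simp add: coeff_fun_def b_def exact_coeff_def inv_gamma_W_def)
qed (simp add: coeff_fun_def)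

lemma exact_coeff_S:
  fixes b :: "tps option \<Rightarrow> real" defines "b \<equiv> exact_coeff inv_gamma_S"
  shows "coeff_mat C1 b t + coeff_fun C1 b t + (coeff_mat C2 b t + coeff_fun C2 b t)
    = osize t * b t"
proof (cases t)
  case (Some \<tau>)
  show ?thesis
  proof (cases \<tau>)
    case (Round m ts)
    then show ?thesis using inv_gamma_S_Round[of m ts] Some
      by (cases m) (simp_all add: coeff_fun_def coeff_mat_def b_def exact_coeff_def)
  next
    case (Square m t')
    then show ?thesis using inv_gamma_S_Square[of m t'] Some
      by (cases m) (simp_all add: coeff_fun_def coeff_mat_def b_def exact_coeff_def)
  qed
qed (simp add: coeff_fun_def coeff_mat_def)

section \<open>Necessity of the order conditions\<close>

text \<open>In both proofs the order assumption is applied to the test problem of a closed set that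
  contains \<open>\<tau>\<close>, and the component of \<open>\<tau>\<close> is read off.\<close>

lemma w_order_condition:
  assumes order: "w_has_order M p" and "tsize \<tau> \<le> p"
  shows "w_coeff M (Some \<tau>) = inv_gamma_W \<tau>"
proof -
  obtain d s where "tree_coordinates d s" and \<tau>: "Some \<tau> \<in> s ` {..<d}"
    by (rule obtain_tree_coordinates)
  then interpret tree_coordinates d s by simp
  let ?b = "exact_coeff inv_gamma_W"
  have "solves_near d (\<lambda>u i. tree_field C1 u i + tree_field C2 u i) 0 (\<lambda>t. embed t ?b)"
    by (rule embed_solves) (simp only: tree_field_embed exact_coeff_W flip: distrib_left)
  then have "(\<lambda>h. norm_d d (\<lambda>i. w_step M (\<lambda>m. scale_op h (tree_field m))
      (\<lambda>m. scale_op h (mat_vec d (tree_matrix m))) (embed 0 ?b) i - embed (0 + h) ?b i))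
      \<in> O[at 0](\<lambda>h. h ^ (p + 1))"
    using order smooth_tree_field unfolding w_has_order_def by blast
  moreover have "w_step M (\<lambda>m. scale_op h (tree_field m))
      (\<lambda>m. scale_op h (mat_vec d (tree_matrix m))) (embed 0 ?b) = embed h (w_coeff M)" for h
  proof -
    have initial: "embed 0 ?b = embed h coeff_y"
      by (rule embed_initial) (simp add: exact_coeff_def)
    show ?thesis unfolding initial w_coeff_def by (rule w_step_T)
  qed
  ultimately have "(\<lambda>h. norm_d d (\<lambda>i. embed h (w_coeff M) i - embed h ?b i))
      \<in> O[at 0](\<lambda>h. h ^ (p + 1))"
    by (simp only: add_0)
  from coefficient_eq_if_embed_bigo[OF this \<tau>] assms(2) show ?thesis
    by (simp add: exact_coeff_def)
qed

lemma split_order_condition: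
  assumes order: "split_has_order M p" and "tsize \<tau> \<le> p"
  shows "split_coeff M (Some \<tau>) = inv_gamma_S \<tau>"
proof -
  obtain d s where "tree_coordinates d s" and \<tau>: "Some \<tau> \<in> s ` {..<d}"
    by (rule obtain_tree_coordinates)
  then interpret tree_coordinates d s by simp
  let ?b = "exact_coeff inv_gamma_S"
  have "solves_near d (split_hF tree_field (\<lambda>m. mat_vec d (tree_matrix m))) 0 (\<lambda>t. embed t ?b)"
    by (rule embed_solves)
      (simp only: split_hF_def split_hf_def tree_field_embed tree_matrix_embed exact_coeff_S
        flip: distrib_left)
  then have "(\<lambda>h. norm_d d (\<lambda>i. psepirk_step M (\<lambda>m. scale_op h (tree_field m))
      (\<lambda>m. scale_op h (mat_vec d (tree_matrix m))) (embed 0 ?b) i - embed (0 + h) ?b i))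
      \<in> O[at 0](\<lambda>h. h ^ (p + 1))"
    using order smooth_tree_field unfolding split_has_order_def by blast
  moreover have "psepirk_step M (\<lambda>m. scale_op h (tree_field m))
      (\<lambda>m. scale_op h (mat_vec d (tree_matrix m))) (embed 0 ?b) = embed h (split_coeff M)" for h
  proof -
    have initial: "embed 0 ?b = embed h coeff_y"
      by (rule embed_initial) (simp add: exact_coeff_def)
    show ?thesis unfolding initial split_coeff_def by (rule psepirk_step_T)
  qed
  ultimately have "(\<lambda>h. norm_d d (\<lambda>i. embed h (split_coeff M) i - embed h ?b i))
      \<in> O[at 0](\<lambda>h. h ^ (p + 1))"
    by (simp only: add_0)
  from coefficient_eq_if_embed_bigo[OF this \<tau>] assms(2) show ?thesis
    by (simp add: exact_coeff_def)
qed

theorem theorem4p4: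
  fixes p :: nat
  assumes "p \<ge> 1"
  shows "(\<forall>M :: w_scheme. w_has_order M p \<longrightarrow>
            (\<forall>\<tau> :: tps. tsize \<tau> \<le> p \<longrightarrow> w_coeff M (Some \<tau>) = inv_gamma_W \<tau>)) \<and>
         (\<forall>M :: psepirk. split_has_order M p \<longrightarrow>
            (\<forall>\<tau> :: tps. tsize \<tau> \<le> p \<longrightarrow> split_coeff M (Some \<tau>) = inv_gamma_S \<tau>))"
  using w_order_condition split_order_condition by blast

end
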